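(* Let $G$ be a tree, let $p>1$ be an integer, and let $H$ be a finite collection of subgraphs of $G$, each consisting of at most $d$ connected components. If $H$ satisfies the $(p,p)$ property, then $\tau(H)< p^{\frac{1}{p-1}}d^{\frac{p}{p-1}} + d$.
   Context: $H$ satisfies the $(p,q)$ property if among any $p$ elements of $H$ there are some $q$ elements sharing a common vertex of $G$. $\tau(H)$ is the minimum size of a set of vertices of $G$ meeting (the vertex set of) every member of $H$.
   Formalization: It is additionally assumed that H has at least p members; otherwise the (p,p) property is vacuous and the bound can fail: for three disjoint one-vertex subtrees with d = 1 and p = 4, τ(H) = 3 exceeds 4^{1/3} + 1. *)

theory Defs
  imports Complex_Main "Graph_Theory.Graph_Theory"
begin

text \<open>
  Undirected simple graphs, possibly infinite, are symmetric loop-free digraphs without parallel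
  arcs (locale \<open>pair_bidirected_digraph\<close>): an edge uv is the pair of arcs (u,v), (v,u).
\<close>

text \<open>
  The library predicates \<open>forest\<close> and \<open>tree\<close> are unsuitable for this representation: an edge
  traversed back and forth is a directed cycle of length 2. The cycles of the undirected graph
  are the directed cycles of length at least 3.
\<close>

definition undirected_tree :: "'a pair_pre_digraph \<Rightarrow> bool" where
  "undirected_tree G \<longleftrightarrow>
     pair_bidirected_digraph G \<and> connected G \<and>
     \<not> (\<exists>c. pre_digraph.cycle G c \<and> length c \<ge> 3)"

text \<open>Symmetry of \<open>h\<close> is needed since the library notion allows dropping one arc of an edge.\<close>

definition undirected_subgraph :: "'a pair_pre_digraph \<Rightarrow> 'a pair_pre_digraph \<Rightarrow> bool" where
  "undirected_subgraph h G \<longleftrightarrow> pair_bidirected_digraph h \<and> subgraph h G"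

text \<open>
  In a symmetric digraph the strongly connected components are the connected components of the
  undirected graph. Finiteness is stated since the cardinality of an infinite set is 0.
\<close>

definition at_most_components :: "nat \<Rightarrow> 'a pair_pre_digraph \<Rightarrow> bool" where
  "at_most_components d h \<longleftrightarrow>
     finite (pre_digraph.sccs_verts h) \<and> card (pre_digraph.sccs_verts h) \<le> d"

text \<open>
  "Any \<open>p\<close> elements" means \<open>p\<close> distinct elements, so the property is vacuous for collections with
  fewer than \<open>p\<close> elements; the usual tacit convention \<open>p \<le> card H\<close> must be stated separately.
  Without it the bound on \<open>tau\<close> is false: take three disjoint one-vertex subtrees, \<open>p = 4\<close>, \<open>d = 1\<close>.
\<close>

definition pq_property ::
    "nat \<Rightarrow> nat \<Rightarrow> 'a pair_pre_digraph \<Rightarrow> 'a pair_pre_digraph set \<Rightarrow> bool" where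
  "pq_property p q G H \<longleftrightarrow>
     (\<forall>S. S \<subseteq> H \<and> finite S \<and> card S = p \<longrightarrow>
        (\<exists>T \<subseteq> S. card T = q \<and> (\<exists>v \<in> pverts G. \<forall>h \<in> T. v \<in> pverts h)))"

definition hitting_set ::
    "'a pair_pre_digraph \<Rightarrow> 'a pair_pre_digraph set \<Rightarrow> 'a set \<Rightarrow> bool" where
  "hitting_set G H C \<longleftrightarrow> C \<subseteq> pverts G \<and> (\<forall>h \<in> H. C \<inter> pverts h \<noteq> {})"

text \<open>
  Meaningful only if a finite hitting set exists, which is the case whenever \<open>H\<close> is a finite
  collection of nonempty subgraphs of \<open>G\<close>.
\<close>

definition tau :: "'a pair_pre_digraph \<Rightarrow> 'a pair_pre_digraph set \<Rightarrow> nat" where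
  "tau G H = (LEAST n. \<exists>C. finite C \<and> hitting_set G H C \<and> card C = n)"

end

theory Submission
  imports Defs "HOL-Library.FuncSet"
begin

text \<open>
  Root the tree and call the vertex of a subtree closest to the root its top. If two subtrees meet,
  the lower of their tops lies in both. Weight the members of \<open>H\<close> arbitrarily, with total weight 1.
  Any \<open>p\<close> members, repetitions allowed, have a common vertex, so the top of a component of one of
  them lies in all the others, and a union bound shows that some vertex meets members of total
  weight at least \<open>l = (p d) powr (- 1 / (p - 1))\<close>. By the multiplicative weights argument, used in
  place of linear programming duality, for each \<open>k < l\<close> there is a list of vertices of which every
  member of \<open>H\<close> contains more than a fraction \<open>k\<close>. Hence every member has a component containing
  more than a fraction \<open>k / d\<close> of the list. Fewer than \<open>d / k\<close> such heavy components are pairwise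
  disjoint, so fewer than \<open>d / k\<close> of their tops suffice to hit them all. The choice
  \<open>k = l / (1 + l)\<close> gives \<open>d / k = d / l + d\<close>, which is the claimed bound.
\<close>

section \<open>Rooted trees\<close>

text \<open>Acyclicity in the form used below: deleting both arcs of an edge separates its ends.
  Loops are excluded as well, since reachability is reflexive.\<close>

locale rooted_bridges =
  fixes E :: "'a rel" and r :: 'a
  assumes sym_E: "sym E"
    and bridge: "(u, v) \<in> E \<Longrightarrow> (u, v) \<notin> (E - {(u, v), (v, u)})\<^sup>*"
begin

text \<open>Distance from the root; unspecified off the component of \<open>r\<close>, whence the
  reachability hypotheses below.\<close>

definition depth :: "'a \<Rightarrow> nat" where
  "depth v = (LEAST n. (r, v) \<in> E ^^ n)"

definition down :: "'a rel" where
  "down = {(u, v) \<in> E. depth u < depth v}"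

definition connected_in :: "'a set \<Rightarrow> bool" where
  "connected_in S \<longleftrightarrow> S \<noteq> {} \<and> S \<subseteq> E\<^sup>* `` {r} \<and> (\<forall>x\<in>S. \<forall>y\<in>S. (x, y) \<in> (E \<inter> S \<times> S)\<^sup>*)"

text \<open>Characterised by descending paths inside \<open>S\<close> rather than by minimal depth,
  because membership is later transported along these paths.\<close>

definition top_vertex :: "'a set \<Rightarrow> 'a" where
  "top_vertex S = (SOME t. t \<in> S \<and> (\<forall>x\<in>S. (t, x) \<in> (down \<inter> S \<times> S)\<^sup>*))"

section \<open>Parents and their uniqueness\<close>

lemma relpow_depth: "(r, v) \<in> E\<^sup>* \<Longrightarrow> (r, v) \<in> E ^^ depth v"
  unfolding depth_def by (rule LeastI_ex) (simp add: rtrancl_power)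

lemma depth_le: "(r, v) \<in> E ^^ n \<Longrightarrow> depth v \<le> n"
  unfolding depth_def by (rule Least_le)

lemma depth_0_imp_root: "(r, v) \<in> E\<^sup>* \<Longrightarrow> depth v = 0 \<Longrightarrow> v = r"
  using relpow_depth by fastforce

lemma parent_exists:
  assumes "(r, v) \<in> E\<^sup>*" "v \<noteq> r"
  obtains u where "(u, v) \<in> E" "(r, u) \<in> E\<^sup>*" "depth u < depth v"
proof -
  obtain n where n: "depth v = Suc n"
    using assms depth_0_imp_root not0_implies_Suc by blast
  then have "(r, v) \<in> E ^^ n O E"
    using relpow_depth[OF assms(1)] by simp
  then obtain u where u: "(r, u) \<in> E ^^ n" "(u, v) \<in> E"
    by auto
  then have "(r, u) \<in> E\<^sup>*" "depth u < depth v"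
    using depth_le[OF u(1)] n by (auto simp: rtrancl_power)
  then show thesis using u(2) that by blast
qed

text \<open>A walk to \<open>u\<close> through successive parents has smaller depth until it ends,
  so it cannot pass \<open>v\<close>, which is at least as deep as \<open>u\<close>.\<close>

lemma reach_avoiding:
  assumes "(r, u) \<in> E\<^sup>*" "u \<noteq> v" "depth u \<le> depth v"
  shows "(r, u) \<in> {(x, y) \<in> E. x \<noteq> v \<and> y \<noteq> v}\<^sup>*"
  using assms
proof (induction "depth u" arbitrary: u rule: less_induct)
  case less
  show ?case
  proof (cases "u = r")
    case False
    then obtain w where w: "(w, u) \<in> E" "(r, w) \<in> E\<^sup>*" "depth w < depth u"
      using less.prems parent_exists by blast
    have wv: "w \<noteq> v" using w less.prems by auto
    have "(r, w) \<in> {(x, y) \<in> E. x \<noteq> v \<and> y \<noteq> v}\<^sup>*"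
      using less.hyps[OF w(3,2) wv] w(3) less.prems by linarith
    then show ?thesis
      using w wv less.prems by (auto intro: rtrancl_into_rtrancl)
  qed simp
qed

text \<open>Otherwise the walk from \<open>v\<close> via \<open>w\<close> and the root to \<open>u\<close> bypasses the bridge \<open>uv\<close>.\<close>

lemma upper_neighbour_unique:
  assumes "(u, v) \<in> E" "(r, u) \<in> E\<^sup>*" "u \<noteq> v" "depth u \<le> depth v"
    and "(w, v) \<in> E" "(r, w) \<in> E\<^sup>*" "w \<noteq> v" "depth w \<le> depth v"
  shows "u = w"
proof (rule ccontr)
  assume "u \<noteq> w"
  let ?A = "{(x, y) \<in> E. x \<noteq> v \<and> y \<noteq> v}" and ?B = "E - {(v, u), (u, v)}"
  have "sym ?A" using sym_E by (auto simp: sym_def)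
  then have "(w, r) \<in> ?A\<^sup>*"
    using reach_avoiding assms by (meson sym_rtrancl symD)
  then have "(w, u) \<in> ?A\<^sup>*"
    using reach_avoiding[of u v] assms by (meson rtrancl_trans)
  moreover have "?A \<subseteq> ?B" by auto
  ultimately have "(w, u) \<in> ?B\<^sup>*"
    using rtrancl_mono by blast
  moreover have "(v, w) \<in> ?B"
    using assms sym_E \<open>u \<noteq> w\<close> by (auto dest: symD)
  ultimately have "(v, u) \<in> ?B\<^sup>*"
    by (meson converse_rtrancl_into_rtrancl)
  then show False
    using bridge[of v u] assms sym_E by (auto dest: symD)
qed

text \<open>If the depths agreed, \<open>u\<close> and a parent of \<open>v\<close> would both be
  neighbours of \<open>v\<close> no deeper than \<open>v\<close>, hence equal, although the parent
  is strictly higher. If \<open>v\<close> is the root, \<open>u\<close> would have depth 0 and be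
  the root too.\<close>

lemma depth_edge:
  assumes "(u, v) \<in> E" "(r, u) \<in> E\<^sup>*"
  shows "depth u < depth v \<or> depth v < depth u"
proof (rule ccontr)
  assume "\<not> ?thesis"
  then have eq: "depth u = depth v" by simp
  have v: "(r, v) \<in> E\<^sup>*" using assms by simp
  have ne: "u \<noteq> v" using bridge[OF assms(1)] by auto
  show False
  proof (cases "v = r")
    case True
    then have "depth v = 0" using depth_le[of v 0] by simp
    then show False using eq True ne depth_0_imp_root[OF assms(2)] by simp
  next
    case False
    then obtain w where w: "(w, v) \<in> E" "(r, w) \<in> E\<^sup>*" "depth w < depth v"
      using v parent_exists by blast
    then have "w \<noteq> v" by blast
    with w have "u = w"
      using upper_neighbour_unique[OF assms ne _ w(1,2)] eq by linarith
    then show False using w eq by simp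
  qed
qed

lemma down_unique:
  assumes "(u, v) \<in> down" "(w, v) \<in> down" "(r, v) \<in> E\<^sup>*"
  shows "u = w"
proof -
  have "(r, u) \<in> E\<^sup>*" "(r, w) \<in> E\<^sup>*"
    using assms sym_E unfolding down_def by (auto dest: symD intro: rtrancl_into_rtrancl)
  then show ?thesis
    using assms upper_neighbour_unique[of u v w] unfolding down_def by auto
qed

text \<open>Follow a walk in \<open>S\<close> from \<open>t\<close>. A step down prolongs the
  descending path; a step up leads to the unique parent, the previous vertex of that path, so the
  last arc is cut off.\<close>

lemma connected_in_down:
  assumes S: "connected_in S" and t: "t \<in> S" "\<And>x. x \<in> S \<Longrightarrow> depth t \<le> depth x" and x: "x \<in> S"
  shows "(t, x) \<in> (down \<inter> S \<times> S)\<^sup>*"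
proof -
  have "(t, x) \<in> (E \<inter> S \<times> S)\<^sup>*"
    using S t x unfolding connected_in_def by blast
  then show ?thesis
  proof induction
    case (step y z)
    then have yz: "(y, z) \<in> E" "y \<in> S" "z \<in> S" by auto
    then have ry: "(r, y) \<in> E\<^sup>*"
      using S unfolding connected_in_def by auto
    show ?case
    proof (cases "depth y < depth z")
      case True
      then show ?thesis
        using step.IH yz by (auto simp: down_def intro: rtrancl_into_rtrancl)
    next
      case False
      then have zy: "(z, y) \<in> down"
        using depth_edge[OF yz(1) ry] yz(1) sym_E by (auto simp: down_def dest: symD)
      \<comment> \<open>Nothing in \<open>S\<close> is higher than \<open>t\<close>, so the
        descending path to \<open>y\<close> has a last arc.\<close>
      then have "y \<noteq> t" using t(2)[OF yz(3)] by (auto simp: down_def)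
      with step.IH obtain w where "(t, w) \<in> (down \<inter> S \<times> S)\<^sup>*" "(w, y) \<in> down"
        by (auto elim: rtranclE)
      then show ?thesis using down_unique[OF zy _ ry] by blast
    qed
  qed simp
qed

section \<open>Tops of connected sets\<close>

lemma top_vertex:
  assumes "connected_in S"
  shows "top_vertex S \<in> S" and "x \<in> S \<Longrightarrow> (top_vertex S, x) \<in> (down \<inter> S \<times> S)\<^sup>*"
proof -
  obtain s where "s \<in> S" using assms unfolding connected_in_def by blast
  \<comment> \<open>Depths are natural numbers, so the minimum is attained for infinite
    \<open>S\<close> as well.\<close>
  then obtain t where "t \<in> S" "\<And>x. x \<in> S \<Longrightarrow> depth t \<le> depth x"
    using arg_min_nat_lemma[of "\<lambda>x. x \<in> S" s depth] by blast
  then have "\<exists>t. t \<in> S \<and> (\<forall>x\<in>S. (t, x) \<in> (down \<inter> S \<times> S)\<^sup>*)"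
    using connected_in_down[OF assms] by blast
  from someI_ex[OF this]
  show "top_vertex S \<in> S" "x \<in> S \<Longrightarrow> (top_vertex S, x) \<in> (down \<inter> S \<times> S)\<^sup>*"
    unfolding top_vertex_def by auto
qed

text \<open>Climb from \<open>x\<close> to the top of \<open>S\<close>. Each vertex left on the way
  is strictly deeper than the top of \<open>S'\<close>, so it has a parent in \<open>S'\<close>; as
  parents are unique, the climb never leaves \<open>S'\<close>.\<close>

lemma top_vertex_mem:
  assumes S: "connected_in S" and S': "connected_in S'" and x: "x \<in> S" "x \<in> S'"
    and le: "depth (top_vertex S') \<le> depth (top_vertex S)"
  shows "top_vertex S \<in> S'"
proof -
  have "(top_vertex S, x) \<in> (down \<inter> S \<times> S)\<^sup>*"
    using top_vertex S x by blast
  then show ?thesis using x(2)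
  proof induction
    case (step y z)
    have rz: "(r, z) \<in> E\<^sup>*"
      using step S' unfolding connected_in_def by auto
    have "depth (top_vertex S) \<le> depth y"
      using step(1) by induction (auto simp: down_def)
    then have "z \<noteq> top_vertex S'"
      using step(2) le by (auto simp: down_def)
    with top_vertex(2)[OF S' step.prems]
    obtain w where w: "w \<in> S'" "(w, z) \<in> down"
      by (auto elim: rtranclE)
    have "(y, z) \<in> down" using step(2) by blast
    then have "w = y" by (rule down_unique[OF w(2) _ rz])
    then show ?case using w step.IH by blast
  qed simp
qed

end

section \<open>Multiplicative weights\<close>

text \<open>
  Every vertex \<open>v\<close> appended to \<open>xs\<close> is heavy for the current weights
  \<open>(1 - e) ^ length (filter (\<lambda>v. v \<in> V h) xs)\<close>, hence lowers their sum by a factor \<open>1 - e * l\<close>.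
\<close>

lemma multiplicative_weights:
  fixes V :: "'h \<Rightarrow> 'v set" and l e :: real
  assumes "finite H" "0 \<le> e" "e < 1"
    and heavy: "\<And>w :: 'h \<Rightarrow> real. (\<And>h. h \<in> H \<Longrightarrow> 0 < w h) \<Longrightarrow>
      \<exists>v. l * (\<Sum>h\<in>H. w h) \<le> (\<Sum>h\<in>H. w h * of_bool (v \<in> V h))"
    and "e * l \<le> 1"
  shows "\<exists>xs. length xs = T \<and>
    (\<Sum>h\<in>H. (1 - e) ^ length (filter (\<lambda>v. v \<in> V h) xs)) \<le> real (card H) * (1 - e * l) ^ T"
proof (induction T)
  case 0
  show ?case by (intro exI[of _ "[]"]) simp
next
  case (Suc T)
  then obtain xs where xs: "length xs = T"
    "(\<Sum>h\<in>H. (1 - e) ^ length (filter (\<lambda>v. v \<in> V h) xs)) \<le> real (card H) * (1 - e * l) ^ T"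
    by blast
  define w where "w h = (1 - e) ^ length (filter (\<lambda>v. v \<in> V h) xs)" for h
  have "0 < w h" for h using assms by (simp add: w_def)
  then obtain v where v: "l * (\<Sum>h\<in>H. w h) \<le> (\<Sum>h\<in>H. w h * of_bool (v \<in> V h))"
    using heavy[of w] by blast
  have "(\<Sum>h\<in>H. (1 - e) ^ length (filter (\<lambda>v. v \<in> V h) (v # xs))) =
      (\<Sum>h\<in>H. w h - e * (w h * of_bool (v \<in> V h)))"
    by (intro sum.cong) (auto simp: w_def algebra_simps)
  also have "\<dots> = (\<Sum>h\<in>H. w h) - e * (\<Sum>h\<in>H. w h * of_bool (v \<in> V h))"
    by (simp add: sum_subtractf sum_distrib_left)
  also have "\<dots> \<le> (1 - e * l) * (\<Sum>h\<in>H. w h)"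
    using mult_left_mono[OF v, of e] assms by (simp add: algebra_simps)
  also have "\<dots> \<le> (1 - e * l) * (real (card H) * (1 - e * l) ^ T)"
    using xs(2) assms by (intro mult_left_mono) (auto simp: w_def)
  finally show ?case
    using xs(1) by (intro exI[of _ "v # xs"]) (simp add: algebra_simps)
qed

text \<open>After \<open>T\<close> rounds the total weight is at most
  \<open>card H * (1 - e * l) ^ T\<close>, whereas a single member hit at most \<open>k * T\<close>
  times weighs at least \<open>(1 - e) powr (k * T)\<close>. As \<open>k < l\<close>, for small
  \<open>e\<close> and large \<open>T\<close> the first bound is the smaller one.\<close>

lemma uniformly_hitting_list:
  fixes V :: "'h \<Rightarrow> 'v set" and l k :: real
  assumes "finite H" "0 < k" "k < l" "l \<le> 1"
    and heavy: "\<And>w :: 'h \<Rightarrow> real. (\<And>h. h \<in> H \<Longrightarrow> 0 < w h) \<Longrightarrow>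
      \<exists>v. l * (\<Sum>h\<in>H. w h) \<le> (\<Sum>h\<in>H. w h * of_bool (v \<in> V h))"
  shows "\<exists>xs. xs \<noteq> [] \<and> (\<forall>h\<in>H. k * length xs < length (filter (\<lambda>v. v \<in> V h) xs))"
proof -
  \<comment> \<open>Any \<open>0 < e < 1 - k / l\<close> gives \<open>k < l * (1 - e)\<close>; this
    is the midpoint.\<close>
  define e where "e = (1 - k / l) / 2"
  have e: "0 < e" "e < 1" using assms by (auto simp: e_def field_simps)
  have "k < l * (1 - e)"
    using assms by (simp add: e_def field_simps)
  have "e * l < 1" using e assms mult_strict_mono[of e 1 l "2"] mult_left_mono[of l 1 e] by linarith
  \<comment> \<open>Applied to the reciprocal, \<open>ln x \<le> x - 1\<close> bounds
    \<open>ln (1 - e)\<close> from below, at the cost of the factor \<open>1 - e\<close> allowed for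
    above.\<close>
  have "ln (1 / (1 - e)) \<le> 1 / (1 - e) - 1"
    using e by (intro ln_le_minus_one) auto
  then have ln_e: "- (e / (1 - e)) \<le> ln (1 - e)"
    using e by (simp add: ln_div field_simps)
  have "ln (1 - e * l) \<le> - (e * l)"
    using ln_le_minus_one[of "1 - e * l"] \<open>e * l < 1\<close> by simp
  also have "\<dots> < k * (- (e / (1 - e)))"
    using mult_strict_left_mono[OF \<open>k < l * (1 - e)\<close> e(1)] e by (simp add: field_simps)
  also have "\<dots> \<le> k * ln (1 - e)"
    using ln_e assms by (intro mult_left_mono) auto
  also have "\<dots> = ln ((1 - e) powr k)"
    using e by (simp add: ln_powr)
  finally have "ln (1 - e * l) < ln ((1 - e) powr k)" .
  then have "1 - e * l < (1 - e) powr k"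
    by (rule iffD1[OF ln_less_cancel_iff, rotated 2]) (use \<open>e * l < 1\<close> e in auto)
  \<comment> \<open>Ratio of the two bounds per round. The \<open>+ 1\<close> below keeps the
    threshold positive when \<open>H\<close> is empty.\<close>
  define b where "b = (1 - e * l) / (1 - e) powr k"
  have b: "0 \<le> b" "b < 1"
    using \<open>1 - e * l < (1 - e) powr k\<close> \<open>e * l < 1\<close> e by (auto simp: b_def)
  obtain n where n: "b ^ n < 1 / (real (card H) + 1)"
    using real_arch_pow_inv[OF _ b(2), of "1 / (real (card H) + 1)"] by auto
  \<comment> \<open>The successor makes the list nonempty.\<close>
  define T where "T = Suc n"
  have "b ^ T \<le> b ^ n"
    unfolding T_def by (rule power_decreasing[OF _ b(1) less_imp_le[OF b(2)]]) simp
  with n have "b ^ T < 1 / (real (card H) + 1)" by linarith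
  then have "b ^ T * (real (card H) + 1) < 1"
    by (simp add: pos_less_divide_eq)
  moreover have "0 \<le> b ^ T" using b(1) by (rule zero_le_power)
  ultimately have "real (card H) * b ^ T < 1"
    by (simp add: algebra_simps)
  then have small: "real (card H) * (1 - e * l) ^ T < ((1 - e) powr k) ^ T"
    using e by (simp add: b_def power_divide pos_divide_less_eq)
  obtain xs where xs: "length xs = T"
    "(\<Sum>h\<in>H. (1 - e) ^ length (filter (\<lambda>v. v \<in> V h) xs)) \<le> real (card H) * (1 - e * l) ^ T"
    using multiplicative_weights[of H e l V T] assms e \<open>e * l < 1\<close> by force
  have "k * length xs < length (filter (\<lambda>v. v \<in> V h) xs)" (is "_ < real ?n") if "h \<in> H" for h
  proof -
    have "(1 - e) powr real ?n = (1 - e) ^ ?n"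
      using e by (simp add: powr_realpow)
    also have "\<dots> \<le> (\<Sum>h\<in>H. (1 - e) ^ length (filter (\<lambda>v. v \<in> V h) xs))"
      using that e assms by (intro member_le_sum) auto
    also have "\<dots> < ((1 - e) powr k) ^ T"
      using xs(2) small by linarith
    also have "\<dots> = (1 - e) powr (k * T)"
      using e by (simp add: powr_powr flip: powr_realpow)
    finally have less: "(1 - e) powr real ?n < (1 - e) powr (k * T)" .
    show ?thesis
    proof (rule ccontr)
      assume "\<not> ?thesis"
      then have "(1 - e) powr (k * T) \<le> (1 - e) powr real ?n"
        using e xs(1) by (intro powr_mono') auto
      with less show False by simp
    qed
  qed
  moreover have "xs \<noteq> []" using xs(1) by (auto simp: T_def)
  ultimately show ?thesis by blast
qed

section \<open>Counting in lists\<close>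

text \<open>Each entry lies in at most one of the disjoint sets, so none is counted twice.\<close>

lemma sum_length_filter_disjoint_le:
  assumes "finite D" "disjoint D"
  shows "(\<Sum>c\<in>D. length (filter (\<lambda>v. v \<in> c) xs)) \<le> length xs"
proof (induction xs)
  case (Cons x xs)
  have "card {c \<in> D. x \<in> c} \<le> 1"
    using assms by (auto simp: card_le_Suc0_iff_eq pairwise_def disjnt_def)
  moreover have "(\<Sum>c\<in>D. length (filter (\<lambda>v. v \<in> c) (x # xs))) =
      (\<Sum>c\<in>D. of_bool (x \<in> c) + length (filter (\<lambda>v. v \<in> c) xs))"
    by (intro sum.cong) auto
  moreover have "\<dots> = card {c \<in> D. x \<in> c} + (\<Sum>c\<in>D. length (filter (\<lambda>v. v \<in> c) xs))"
    using assms(1) by (simp add: sum.distrib Int_def)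
  ultimately show ?case using Cons by simp
qed simp

lemma length_filter_Union_le:
  assumes "finite K"
  shows "length (filter (\<lambda>v. v \<in> \<Union>K) xs) \<le> (\<Sum>c\<in>K. length (filter (\<lambda>v. v \<in> c) xs))"
proof (induction xs)
  case (Cons x xs)
  have "of_bool (x \<in> \<Union>K) \<le> (\<Sum>c\<in>K. of_bool (x \<in> c) :: nat)"
  proof (cases "x \<in> \<Union>K")
    case True
    then obtain c where "c \<in> K" "x \<in> c" by blast
    then show ?thesis
      using member_le_sum[of c K "\<lambda>c. of_bool (x \<in> c) :: nat"] assms by auto
  qed simp
  moreover have "(\<Sum>c\<in>K. length (filter (\<lambda>v. v \<in> c) (x # xs))) =
      (\<Sum>c\<in>K. of_bool (x \<in> c)) + (\<Sum>c\<in>K. length (filter (\<lambda>v. v \<in> c) xs))"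
    unfolding sum.distrib[symmetric] by (intro sum.cong) auto
  moreover have "length (filter (\<lambda>v. v \<in> \<Union>K) (x # xs)) =
      of_bool (x \<in> \<Union>K) + length (filter (\<lambda>v. v \<in> \<Union>K) xs)"
    by simp
  ultimately show ?case using Cons by linarith
qed simp

section \<open>Families of sets with tops\<close>

text \<open>All that is retained of the tree: when two sets meet, the lower top, that of larger
  rank, lies in both.\<close>

locale topped_family =
  fixes C :: "'v set set" and t :: "'v set \<Rightarrow> 'v" and rank :: "'v \<Rightarrow> nat"
  assumes top_in: "c \<in> C \<Longrightarrow> t c \<in> c"
    and top_mem: "\<lbrakk>c \<in> C; c' \<in> C; c \<inter> c' \<noteq> {}; rank (t c') \<le> rank (t c)\<rbrakk> \<Longrightarrow> t c \<in> c'"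
begin

text \<open>Greedy choice: take \<open>c\<close> with the lowest top. Every member meeting
  \<open>c\<close> contains \<open>t c\<close>, so the members that do not contain
  \<open>t c\<close> are disjoint from \<open>c\<close>, and induction applies to them.\<close>

lemma disjoint_subfamily_tops_hit:
  assumes "finite F" "F \<subseteq> C"
  shows "\<exists>D\<subseteq>F. disjoint D \<and> (\<forall>c\<in>F. \<exists>c'\<in>D. t c' \<in> c)"
  using assms
proof (induction F rule: finite_psubset_induct)
  case (psubset F)
  show ?case
  proof (cases "F = {}")
    case False
    then obtain c where c: "c \<in> F" "\<And>c'. c' \<in> F \<Longrightarrow> rank (t c') \<le> rank (t c)"
      using obtains_MAX[OF psubset(1), of "\<lambda>c. rank (t c)"]
      by (metis Max_ge finite_imageI imageI psubset(1))
    let ?F = "{c' \<in> F. t c \<notin> c'}"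
    have "t c \<in> c" using top_in c(1) psubset.prems by blast
    then have "?F \<subset> F" using c(1) by blast
    then obtain D where D: "D \<subseteq> ?F" "disjoint D" "\<forall>c\<in>?F. \<exists>c'\<in>D. t c' \<in> c"
      using psubset.IH[of ?F] psubset.prems by blast
    have "c \<inter> c' = {}" if "c' \<in> D" for c'
      using top_mem[of c c'] c that D(1) psubset.prems by blast
    then have "disjoint (insert c D)"
      using D(2) by (auto simp: pairwise_insert disjnt_def Int_commute)
    then show ?thesis
      using D c(1) by (intro exI[of _ "insert c D"]) auto
  qed auto
qed

text \<open>
  Choose \<open>p\<close> members of \<open>H\<close> independently, with probability proportional to \<open>w\<close>. Their common
  vertex lies in one component of each of them, and the lowest of the tops of these components
  lies in all of them. A union bound over the position of that component gives the estimate.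
\<close>

lemma heavy_vertex:
  fixes w :: "'h \<Rightarrow> real" and K :: "'h \<Rightarrow> 'v set set"
  assumes H: "finite H" "H \<noteq> {}" and "0 < p"
    and K: "\<And>h. h \<in> H \<Longrightarrow> K h \<subseteq> C" "\<And>h. h \<in> H \<Longrightarrow> finite (K h)" "\<And>h. h \<in> H \<Longrightarrow> card (K h) \<le> d"
    and meet: "\<And>f. f \<in> {..<p} \<rightarrow>\<^sub>E H \<Longrightarrow> \<exists>v. \<forall>i<p. v \<in> \<Union>(K (f i))"
    and w: "\<And>h. h \<in> H \<Longrightarrow> 0 < w h"
  shows "\<exists>v. (\<Sum>h\<in>H. w h) ^ (p - 1) \<le>
    real p * real d * (\<Sum>h\<in>H. w h * of_bool (v \<in> \<Union>(K h))) ^ (p - 1)"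
proof -
  define A where "A = \<Union>(K ` H)"
  define W where "W = (\<Sum>h\<in>H. w h)"
  define m where "m v = (\<Sum>h\<in>H. w h * of_bool (v \<in> \<Union>(K h)))" for v
  \<comment> \<open>\<open>w h\<close> times the condition imposed on position \<open>j\<close>: to
    have \<open>c\<close> as a component if \<open>j = i\<close>, to contain \<open>t c\<close>
    otherwise. Each condition concerns one position only, so sums over all tuples factorise.\<close>
  define g where "g i c j h = w h * (if j = i then of_bool (c \<in> K h) else of_bool (t c \<in> \<Union>(K h)))"
    for i j :: nat and c h
  have A: "finite A" "A \<subseteq> C" using H K by (auto simp: A_def)
  have W: "0 < W" unfolding W_def using H w by (intro sum_pos) auto
  have m0: "0 \<le> m v" for v unfolding m_def using w by (intro sum_nonneg) (simp add: less_imp_le)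
  have g0: "0 \<le> g i c j h" if "h \<in> H" for i c j h
    using w[OF that] by (simp add: g_def)
  have cover: "\<exists>i<p. \<exists>c\<in>A. (\<Prod>j<p. w (f j)) = (\<Prod>j<p. g i c j (f j))"
    if f: "f \<in> {..<p} \<rightarrow>\<^sub>E H" for f
  proof -
    obtain v where "\<forall>i<p. v \<in> \<Union>(K (f i))" using meet[OF f] by blast
    then have "\<forall>i. \<exists>c. i < p \<longrightarrow> c \<in> K (f i) \<and> v \<in> c" by blast
    then obtain c where c: "\<And>i. i < p \<Longrightarrow> c i \<in> K (f i) \<and> v \<in> c i" by metis
    have fH: "f i \<in> H" if "i < p" for i using f that by auto
    obtain i where i: "i < p" "\<And>j. j < p \<Longrightarrow> rank (t (c j)) \<le> rank (t (c i))"
    proof -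
      have "Max ((\<lambda>j. rank (t (c j))) ` {..<p}) \<in> (\<lambda>j. rank (t (c j))) ` {..<p}"
        using \<open>0 < p\<close> by (intro Max_in) auto
      then obtain i where "i < p" "Max ((\<lambda>j. rank (t (c j))) ` {..<p}) = rank (t (c i))"
        by auto
      then show thesis
        by (intro that[of i]) (auto intro!: Max_ge simp flip: \<open>Max _ = _\<close>)
    qed
    have "t (c i) \<in> c j" if "j < p" for j
    proof (rule top_mem)
      show "c i \<in> C" "c j \<in> C" using c K(1) fH i(1) that by blast+
      show "c i \<inter> c j \<noteq> {}" using c i(1) that by blast
    qed (use i that in auto)
    then have "t (c i) \<in> \<Union>(K (f j))" if "j < p" for j
      using c that by blast
    then have "g i (c i) j (f j) = w (f j)" if "j < p" for j
      using c i that by (auto simp: g_def)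
    then have "(\<Prod>j<p. w (f j)) = (\<Prod>j<p. g i (c i) j (f j))"
      by (intro prod.cong) auto
    moreover have "c i \<in> A" using c fH i by (auto simp: A_def)
    ultimately show ?thesis using i(1) by blast
  qed
  have "{..<p} \<rightarrow>\<^sub>E H \<noteq> {}" using H by (simp add: PiE_eq_empty_iff)
  then have "A \<noteq> {}" using cover by blast
  \<comment> \<open>The witness will be the top that meets the greatest weight.\<close>
  have "Max ((\<lambda>c. m (t c)) ` A) \<in> (\<lambda>c. m (t c)) ` A"
    using A(1) \<open>A \<noteq> {}\<close> by (intro Max_in) auto
  then obtain c0 where "c0 \<in> A" "Max ((\<lambda>c. m (t c)) ` A) = m (t c0)" by auto
  then have c0: "m (t c) \<le> m (t c0)" if "c \<in> A" for c
    using A(1) that by (metis Max_ge finite_imageI imageI)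
  have prod_le: "(\<Prod>j<p. w (f j)) \<le> (\<Sum>i<p. \<Sum>c\<in>A. \<Prod>j<p. g i c j (f j))"
    if f: "f \<in> {..<p} \<rightarrow>\<^sub>E H" for f
  proof -
    obtain i c where ic: "i < p" "c \<in> A" "(\<Prod>j<p. w (f j)) = (\<Prod>j<p. g i c j (f j))"
      using cover[OF f] by blast
    have nn: "0 \<le> (\<Prod>j<p. g i c j (f j))" for i c
      using f by (intro prod_nonneg g0) auto
    have "(\<Prod>j<p. g i c j (f j)) \<le> (\<Sum>c\<in>A. \<Prod>j<p. g i c j (f j))"
      using ic(2) A(1) nn by (intro member_le_sum) auto
    also have "\<dots> \<le> (\<Sum>i<p. \<Sum>c\<in>A. \<Prod>j<p. g i c j (f j))"
      using ic(1) nn by (intro member_le_sum[of i "{..<p}" "\<lambda>i. \<Sum>c\<in>A. \<Prod>j<p. g i c j (f j)"])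
        (auto intro: sum_nonneg)
    finally show ?thesis using ic(3) by simp
  qed
  have factor: "(\<Prod>j<p. \<Sum>h\<in>H. g i c j h) = (\<Sum>h\<in>H. w h * of_bool (c \<in> K h)) * m (t c) ^ (p - 1)"
    if "i < p" for i c
  proof -
    have "(\<Prod>j<p. \<Sum>h\<in>H. g i c j h) = (\<Sum>h\<in>H. g i c i h) * (\<Prod>j\<in>{..<p} - {i}. \<Sum>h\<in>H. g i c j h)"
      using that by (intro prod.remove) auto
    also have "(\<Prod>j\<in>{..<p} - {i}. \<Sum>h\<in>H. g i c j h) = (\<Prod>j\<in>{..<p} - {i}. m (t c))"
      by (intro prod.cong) (auto simp: g_def m_def)
    finally show ?thesis using that by (simp add: g_def)
  qed
  \<comment> \<open>Expand \<open>W ^ p\<close> over all tuples, apply the union bound, factorise by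
    positions, and replace every \<open>m (t c)\<close> by the maximum. What remains counts the
    components of each member, at most \<open>d\<close>.\<close>
  have "W ^ p = (\<Prod>j<p. \<Sum>h\<in>H. w h)" by (simp add: W_def)
  also have "\<dots> = (\<Sum>f\<in>{..<p} \<rightarrow>\<^sub>E H. \<Prod>j<p. w (f j))"
    using H by (intro prod_sum_PiE) auto
  also have "\<dots> \<le> (\<Sum>f\<in>{..<p} \<rightarrow>\<^sub>E H. \<Sum>i<p. \<Sum>c\<in>A. \<Prod>j<p. g i c j (f j))"
    by (intro sum_mono prod_le)
  also have "\<dots> = (\<Sum>i<p. \<Sum>f\<in>{..<p} \<rightarrow>\<^sub>E H. \<Sum>c\<in>A. \<Prod>j<p. g i c j (f j))"
    by (rule sum.swap)
  also have "\<dots> = (\<Sum>i<p. \<Sum>c\<in>A. \<Sum>f\<in>{..<p} \<rightarrow>\<^sub>E H. \<Prod>j<p. g i c j (f j))"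
    by (intro sum.cong sum.swap refl)
  also have "\<dots> = (\<Sum>i<p. \<Sum>c\<in>A. \<Prod>j<p. \<Sum>h\<in>H. g i c j h)"
    using H by (intro sum.cong refl prod_sum_PiE[symmetric]) auto
  also have "\<dots> = (\<Sum>i<p. \<Sum>c\<in>A. (\<Sum>h\<in>H. w h * of_bool (c \<in> K h)) * m (t c) ^ (p - 1))"
    by (intro sum.cong refl factor) auto
  also have "\<dots> \<le> (\<Sum>i<p. \<Sum>c\<in>A. (\<Sum>h\<in>H. w h * of_bool (c \<in> K h)) * m (t c0) ^ (p - 1))"
    using c0 m0 w by (intro sum_mono mult_left_mono power_mono sum_nonneg) (auto simp: less_imp_le)
  also have "\<dots> = real p * m (t c0) ^ (p - 1) * (\<Sum>c\<in>A. \<Sum>h\<in>H. w h * of_bool (c \<in> K h))"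
    by (simp add: sum_distrib_left sum_distrib_right mult_ac)
  also have "(\<Sum>c\<in>A. \<Sum>h\<in>H. w h * of_bool (c \<in> K h)) = (\<Sum>h\<in>H. \<Sum>c\<in>A. w h * of_bool (c \<in> K h))"
    by (rule sum.swap)
  also have "\<dots> = (\<Sum>h\<in>H. w h * real (card (K h)))"
  proof (intro sum.cong refl)
    fix h assume "h \<in> H"
    then have "A \<inter> K h = K h" by (auto simp: A_def)
    then show "(\<Sum>c\<in>A. w h * of_bool (c \<in> K h)) = w h * real (card (K h))"
      using A(1) by (simp flip: sum_distrib_left add: Int_def)
  qed
  also have "real p * m (t c0) ^ (p - 1) * (\<Sum>h\<in>H. w h * real (card (K h))) \<le>
      real p * m (t c0) ^ (p - 1) * (\<Sum>h\<in>H. w h * real d)"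
    using K w m0 by (intro mult_left_mono sum_mono) (auto simp: less_imp_le)
  also have "\<dots> = real p * real d * m (t c0) ^ (p - 1) * W"
    by (simp add: W_def sum_distrib_left mult_ac)
  \<comment> \<open>Position \<open>i\<close> contributes \<open>d * W\<close>; cancelling this
    \<open>W\<close> leaves the exponent \<open>p - 1\<close>.\<close>
  finally have "W ^ (p - 1) * W \<le> real p * real d * m (t c0) ^ (p - 1) * W"
    using \<open>0 < p\<close> by (simp add: power_eq_if mult.commute)
  then have "W ^ (p - 1) \<le> real p * real d * m (t c0) ^ (p - 1)"
    using W by (rule mult_right_le_imp_le)
  then show ?thesis
    unfolding W_def m_def by blast
qed

lemma small_hitting_set:
  fixes K :: "'h \<Rightarrow> 'v set set"
  assumes H: "finite H" "H \<noteq> {}" and "1 < p"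
    and K: "\<And>h. h \<in> H \<Longrightarrow> K h \<subseteq> C" "\<And>h. h \<in> H \<Longrightarrow> finite (K h)" "\<And>h. h \<in> H \<Longrightarrow> card (K h) \<le> d"
    and meet: "\<And>f. f \<in> {..<p} \<rightarrow>\<^sub>E H \<Longrightarrow> \<exists>v. \<forall>i<p. v \<in> \<Union>(K (f i))"
  shows "\<exists>X\<subseteq>\<Union>(\<Union>(K ` H)). finite X \<and> (\<forall>h\<in>H. X \<inter> \<Union>(K h) \<noteq> {}) \<and>
    real (card X) < real p powr (1 / (real p - 1)) * real d powr (real p / (real p - 1)) + real d"
proof -
  define A where "A = \<Union>(K ` H)"
  have A: "finite A" "A \<subseteq> C" using H K by (auto simp: A_def)
  \<comment> \<open>The solution of \<open>l ^ (p - 1) * (p * d) = 1\<close>, so that taking roots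
    in \<open>heavy_vertex\<close> yields the fraction \<open>l\<close>.\<close>
  define l where "l = (real p * real d) powr (- (1 / (real p - 1)))"
  obtain h0 where h0: "h0 \<in> H" using H by blast
  \<comment> \<open>A constant tuple shows that \<open>h0\<close> has a vertex, hence a component,
    so \<open>d\<close> is positive.\<close>
  have "(\<lambda>i\<in>{..<p}. h0) \<in> {..<p} \<rightarrow>\<^sub>E H" using h0 by auto
  from meet[OF this] obtain v where "\<forall>i<p. v \<in> \<Union>(K ((\<lambda>i\<in>{..<p}. h0) i))" by blast
  then have "v \<in> \<Union>(K h0)" using \<open>1 < p\<close> by (auto dest: spec[of _ 0])
  then have "K h0 \<noteq> {}" by blast
  then have "0 < d" using K(2,3)[OF h0] by (metis card_gt_0_iff gr0I le_zero_eq)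
  then have pd: "1 \<le> real p * real d"
    using \<open>1 < p\<close> by (metis Suc_leI less_imp_le_nat mult_le_mono nat_mult_1 of_nat_1 of_nat_le_iff of_nat_mult One_nat_def)
  have "0 < l" using \<open>0 < d\<close> \<open>1 < p\<close> by (simp add: l_def)
  have "l \<le> 1" using powr_mono[of "- (1 / (real p - 1))" 0 "real p * real d"] pd \<open>1 < p\<close> \<open>0 < d\<close>
    by (auto simp: l_def split: if_splits)
  have lp: "l ^ (p - 1) * (real p * real d) = 1"
  proof -
    have "l ^ (p - 1) = l powr (real p - 1)"
      using \<open>0 < l\<close> \<open>1 < p\<close> by (simp add: powr_realpow[symmetric] of_nat_diff)
    also have "\<dots> = (real p * real d) powr - 1"
      using \<open>1 < p\<close> by (simp add: l_def powr_powr)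
    finally show ?thesis using \<open>0 < d\<close> \<open>1 < p\<close> by (simp add: powr_minus field_simps)
  qed
  have heavy: "\<exists>v. l * (\<Sum>h\<in>H. w h) \<le> (\<Sum>h\<in>H. w h * of_bool (v \<in> \<Union>(K h)))"
    if w: "\<And>h. h \<in> H \<Longrightarrow> 0 < w h" for w
  proof -
    have "\<exists>v. (\<Sum>h\<in>H. w h) ^ (p - 1) \<le>
        real p * real d * (\<Sum>h\<in>H. w h * of_bool (v \<in> \<Union>(K h))) ^ (p - 1)"
      by (rule heavy_vertex[OF H _ K meet w]) (use \<open>1 < p\<close> in simp_all)
    then obtain v where v: "(\<Sum>h\<in>H. w h) ^ (p - 1) \<le>
        real p * real d * (\<Sum>h\<in>H. w h * of_bool (v \<in> \<Union>(K h))) ^ (p - 1)" (is "?W ^ _ \<le> _ * ?m ^ _")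
      by blast
    have "(l * ?W) ^ (p - 1) \<le> l ^ (p - 1) * (real p * real d * ?m ^ (p - 1))"
      unfolding power_mult_distrib using v \<open>0 < l\<close> by (intro mult_left_mono) auto
    also have "\<dots> = l ^ (p - 1) * (real p * real d) * ?m ^ (p - 1)"
      by (rule mult.assoc[symmetric])
    also have "\<dots> = ?m ^ (p - 1)"
      unfolding lp by (rule mult_1)
    finally have le: "(l * ?W) ^ (p - 1) \<le> ?m ^ (p - 1)" .
    have "l * ?W \<le> ?m"
    proof (rule power_le_imp_le_base)
      have "p - 1 = Suc (p - 2)" using \<open>1 < p\<close> by simp
      then show "(l * ?W) ^ Suc (p - 2) \<le> ?m ^ Suc (p - 2)" using le by (simp only:)
      show "0 \<le> ?m" using w by (intro sum_nonneg) (simp add: less_imp_le)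
    qed
    then show ?thesis by blast
  qed
  define k where "k = l / (1 + l)"
  have k: "0 < k" "k < l" using \<open>0 < l\<close> by (auto simp: k_def field_simps)
  obtain xs where xs: "xs \<noteq> []"
    "\<And>h. h \<in> H \<Longrightarrow> k * length xs < length (filter (\<lambda>v. v \<in> \<Union>(K h)) xs)"
    using uniformly_hitting_list[OF H(1) k \<open>l \<le> 1\<close> heavy] by blast
  let ?n = "\<lambda>c. length (filter (\<lambda>v. v \<in> c) xs)"
  define F where "F = {c \<in> A. k * length xs < d * ?n c}"
  \<comment> \<open>If all of the at most \<open>d\<close> components were light, their union would
    hold at most a fraction \<open>k\<close> of the list.\<close>
  have heavy_component: "\<exists>c\<in>F. c \<in> K h" if h: "h \<in> H" for h
  proof (rule ccontr)
    assume "\<not> ?thesis"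
    then have light: "real d * ?n c \<le> k * length xs" if "c \<in> K h" for c
      using h that by (force simp: F_def A_def)
    have "real d * (k * length xs) < real d * ?n (\<Union>(K h))"
      using xs(2)[OF h] \<open>0 < d\<close> by (intro mult_strict_left_mono) auto
    also have "\<dots> \<le> real d * real (\<Sum>c\<in>K h. ?n c)"
      using length_filter_Union_le[OF K(2)[OF h], of xs] by (intro mult_left_mono of_nat_mono) auto
    also have "\<dots> = (\<Sum>c\<in>K h. real d * ?n c)"
      by (simp add: sum_distrib_left)
    also have "\<dots> \<le> (\<Sum>c\<in>K h. k * length xs)"
      by (intro sum_mono light)
    also have "\<dots> = real (card (K h)) * (k * length xs)" by simp
    also have "\<dots> \<le> real d * (k * length xs)"
      using K(3)[OF h] k by (intro mult_right_mono) auto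
    finally show False by simp
  qed
  have "F \<subseteq> A" by (auto simp: F_def)
  then have "finite F" "F \<subseteq> C" using A finite_subset by blast+
  then obtain D where D: "D \<subseteq> F" "disjoint D" "\<And>c. c \<in> F \<Longrightarrow> \<exists>c'\<in>D. t c' \<in> c"
    using disjoint_subfamily_tops_hit by metis
  then have "finite D" using \<open>finite F\<close> finite_subset by blast
  have "D \<noteq> {}" using heavy_component[OF h0] D(3) by blast
  \<comment> \<open>Disjoint heavy components share out the entries of the list; strictness comes
    from \<open>D\<close> being nonempty.\<close>
  have "real (card D) * (k * length xs) = (\<Sum>c\<in>D. k * length xs)" by simp
  also have "\<dots> < (\<Sum>c\<in>D. real d * ?n c)"
    using D(1) \<open>finite D\<close> \<open>D \<noteq> {}\<close> by (intro sum_strict_mono) (auto simp: F_def)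
  also have "\<dots> = real d * real (\<Sum>c\<in>D. ?n c)"
    by (simp add: sum_distrib_left)
  also have "\<dots> \<le> real d * length xs"
    using sum_length_filter_disjoint_le[OF \<open>finite D\<close> D(2), of xs]
    by (intro mult_left_mono of_nat_mono) auto
  finally have "real (card D) * k < real d"
    using xs(1) by (simp add: mult.assoc[symmetric])
  then have "real (card D) < real d / k"
    using k by (simp add: field_simps)
  also have "\<dots> = real d / l + real d"
    using \<open>0 < l\<close> by (simp add: k_def field_simps)
  also have "real d / l = real d * (real p * real d) powr (1 / (real p - 1))"
    by (simp add: l_def powr_minus divide_inverse)
  also have "\<dots> = real p powr (1 / (real p - 1)) * (real d powr (1 / (real p - 1)) * real d powr 1)"
    using \<open>0 < d\<close> by (simp add: powr_mult mult_ac)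
  \<comment> \<open>The exponents add up as \<open>1 / (p - 1) + 1 = p / (p - 1)\<close>.\<close>
  also have "real d powr (1 / (real p - 1)) * real d powr 1 = real d powr (real p / (real p - 1))"
    unfolding powr_add[symmetric] using \<open>1 < p\<close> by (simp add: field_simps)
  finally have "real (card (t ` D)) <
      real p powr (1 / (real p - 1)) * real d powr (real p / (real p - 1)) + real d"
    using card_image_le[OF \<open>finite D\<close>, of t] by linarith
  moreover have "t ` D \<subseteq> \<Union>(\<Union>(K ` H))"
  proof (rule image_subsetI)
    fix c assume "c \<in> D"
    then have "c \<in> A" using D(1) \<open>F \<subseteq> A\<close> by blast
    moreover from this have "t c \<in> c" using A(2) top_in by blast
    ultimately show "t c \<in> \<Union>(\<Union>(K ` H))" unfolding A_def by (rule UnionI)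
  qed
  moreover have "t ` D \<inter> \<Union>(K h) \<noteq> {}" if h: "h \<in> H" for h
  proof -
    obtain c where c: "c \<in> F" "c \<in> K h" using heavy_component[OF h] by blast
    obtain c' where "c' \<in> D" "t c' \<in> c" using D(3)[OF c(1)] by blast
    then show ?thesis using c(2) by blast
  qed
  ultimately show ?thesis
    using \<open>finite D\<close> by (intro exI[of _ "t ` D"] conjI ballI finite_imageI)
qed

end

section \<open>Trees and their subgraphs\<close>

text \<open>A path from \<open>u\<close> to \<open>v\<close> avoiding the edge, closed up by the arc
  \<open>(v, u)\<close>, is a cycle. The path is neither empty nor the single arc
  \<open>(u, v)\<close>, so the cycle has length at least 3.\<close>

lemma undirected_tree_bridge:
  assumes G: "undirected_tree G" and uv: "(u, v) \<in> parcs G"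
  shows "(u, v) \<notin> (parcs G - {(u, v), (v, u)})\<^sup>*"
proof
  assume reach: "(u, v) \<in> (parcs G - {(u, v), (v, u)})\<^sup>*"
  interpret G: pair_bidirected_digraph G using G by (simp add: undirected_tree_def)
  define G' where "G' = \<lparr>pverts = pverts G, parcs = parcs G - {(u, v), (v, u)}\<rparr>"
  interpret G': pair_wf_digraph G'
    by unfold_locales (auto simp: G'_def G.arc_fst_in_verts G.arc_snd_in_verts G.in_arcsD1 G.in_arcsD2)
  have "u \<in> pverts G'" using uv by (auto simp: G'_def G.in_arcsD1)
  then have "u \<rightarrow>\<^sup>*\<^bsub>G'\<^esub> v"
    using reach by (subst G'.reachable_conv') (auto simp: G'_def)
  then obtain q where "G'.apath u q v" using G'.reachable_apath by blast
  then have "set q \<subseteq> parcs G'" and q: "pcas u q v" "distinct (pawalk_verts u q)"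
    by (auto simp: G'.apath_def G'.awalk_def)
  then have q_avoids: "set q \<subseteq> parcs G - {(u, v), (v, u)}" by (simp add: G'_def)
  have "u \<noteq> v" using uv G.pair_no_loops by fastforce
  then have "2 \<le> length q"
    using q(1) q_avoids by (cases q; cases "tl q") auto
  moreover have "G.cycle ((v, u) # q)"
  proof -
    have "(v, u) \<in> parcs G" using uv G.pair_sym_arcs by (auto simp: symmetric_def dest: symD)
    then have "G.awalk v ((v, u) # q) v"
      using q(1) q_avoids by (auto simp: G.awalk_def G.in_arcsD1 G.in_arcsD2)
    then show ?thesis using q by (auto simp: G.cycle_def)
  qed
  ultimately have "\<exists>c. G.cycle c \<and> length c \<ge> 3" by (intro exI[of _ "(v, u) # q"]) auto
  then show False using G by (simp add: undirected_tree_def)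
qed

lemma undirected_tree_rooted_bridges:
  assumes "undirected_tree G"
  shows "rooted_bridges (parcs G)"
proof
  interpret G: pair_bidirected_digraph G using assms by (simp add: undirected_tree_def)
  show "sym (parcs G)" using G.pair_sym_arcs by (simp add: symmetric_def)
qed (rule undirected_tree_bridge[OF assms])

lemma undirected_tree_reachable:
  assumes "undirected_tree G" "u \<in> pverts G" "v \<in> pverts G"
  shows "(u, v) \<in> (parcs G)\<^sup>*"
proof -
  interpret G: pair_bidirected_digraph G using assms by (simp add: undirected_tree_def)
  have "connected G" using assms by (simp add: undirected_tree_def)
  then have "strongly_connected G"
    using G.symmetric_connected_imp_strongly_connected G.pair_sym_arcs by blast
  then have "u \<rightarrow>\<^sup>*\<^bsub>G\<^esub> v" using assms by (auto simp: strongly_connected_def)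
  then show ?thesis using G.reachable_conv by auto
qed

section \<open>Components of subgraphs\<close>

lemma Union_sccs_verts:
  assumes "pair_bidirected_digraph h"
  shows "\<Union>(pre_digraph.sccs_verts h) = pverts h"
proof -
  interpret h: pair_bidirected_digraph h by (rule assms)
  show ?thesis
  proof (intro equalityI subsetI)
    fix v assume "v \<in> \<Union>h.sccs_verts"
    then show "v \<in> pverts h" by (auto simp: h.sccs_verts_def dest: h.reachable_in_verts)
  next
    fix v assume "v \<in> pverts h"
    then have "h.scc_of v \<in> h.sccs_verts" "v \<in> h.scc_of v"
      by (auto simp: h.scc_of_in_sccs_verts h.in_scc_of_self)
    then show "v \<in> \<Union>h.sccs_verts" by blast
  qed
qed

text \<open>Whatever \<open>x\<close> reaches in \<open>h\<close> also reaches \<open>x\<close> by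
  symmetry, so it belongs to the same component and the walk never leaves \<open>c\<close>.\<close>

lemma sccs_verts_connected:
  assumes h: "pair_bidirected_digraph h" and c: "c \<in> pre_digraph.sccs_verts h" "x \<in> c" "y \<in> c"
  shows "(x, y) \<in> (parcs h \<inter> c \<times> c)\<^sup>*"
proof -
  interpret h: pair_bidirected_digraph h by (rule h)
  have "x \<rightarrow>\<^sup>*\<^bsub>h\<^esub> y" using c by (auto simp: h.sccs_verts_def)
  then have "(x, y) \<in> (parcs h)\<^sup>*" "x \<in> pverts h" using h.reachable_conv by auto
  then have "y \<in> c \<and> (x, y) \<in> (parcs h \<inter> c \<times> c)\<^sup>*"
  proof induction
    case (step y z)
    then have "x \<rightarrow>\<^sup>*\<^bsub>h\<^esub> z" using h.reachable_conv' by (meson rtrancl_into_rtrancl)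
    then have "z \<in> c" using c symmetric_reachable[OF h.pair_sym_arcs] by (auto simp: h.sccs_verts_def)
    then show ?case using step by (auto intro: rtrancl_into_rtrancl)
  qed (use c in simp)
  then show ?thesis ..
qed

text \<open>A tuple with repetitions has fewer than \<open>p\<close> distinct members. As
  \<open>p \<le> card H\<close>, they extend to exactly \<open>p\<close> members, whose only subset
  of size \<open>p\<close> is the whole.\<close>

lemma pq_property_common_vertex:
  assumes pq: "pq_property p p G H" and "p \<le> card H" "finite H" "S \<subseteq> H" "card S \<le> p"
  shows "\<exists>v. \<forall>h\<in>S. v \<in> pverts h"
proof -
  obtain S' where S': "S \<subseteq> S'" "S' \<subseteq> H" "card S' = p"
    using exists_subset_between[of S p H] assms by auto
  then have "finite S'" using assms finite_subset by blast
  then obtain T v where "T \<subseteq> S'" "card T = p" "\<forall>h\<in>T. v \<in> pverts h"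
    using pq[unfolded pq_property_def, rule_format, of S'] S' by blast
  moreover from this have "T = S'" using card_subset_eq \<open>finite S'\<close> S'(3) by metis
  ultimately show ?thesis using S'(1) by blast
qed

theorem theorem1p3:
  fixes G :: "'a pair_pre_digraph"
    and H :: "'a pair_pre_digraph set"
    and p d :: nat
  assumes "undirected_tree G"
    and "p > 1"
    and "finite H"
    and "\<And>h. h \<in> H \<Longrightarrow> undirected_subgraph h G"
    and "\<And>h. h \<in> H \<Longrightarrow> at_most_components d h"
    and "p \<le> card H"
    and "pq_property p p G H"
  shows "real (tau G H)
    < real p powr (1 / (real p - 1)) * real d powr (real p / (real p - 1)) + real d"
proof -
  have "H \<noteq> {}" using assms by auto
  have "pverts G \<noteq> {}"
    using assms(1) by (auto simp: undirected_tree_def connected_conv)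
  then obtain r where r: "r \<in> pverts G" by blast
  interpret rooted_bridges "parcs G" r
    using undirected_tree_rooted_bridges[OF assms(1)] .
  \<comment> \<open>The family consists of all connected vertex sets, so it contains the components
    of every member; depth serves as rank.\<close>
  interpret topped_family "{S. connected_in S}" top_vertex depth
    using top_vertex(1) top_vertex_mem by unfold_locales auto
  let ?K = "\<lambda>h :: 'a pair_pre_digraph. pre_digraph.sccs_verts h"
  have bi: "pair_bidirected_digraph h" and sub: "pverts h \<subseteq> pverts G" "parcs h \<subseteq> parcs G"
    if "h \<in> H" for h
    using assms(4)[OF that] by (auto simp: undirected_subgraph_def subgraph_def)
  have UnK: "\<Union>(?K h) = pverts h" if "h \<in> H" for h
    using Union_sccs_verts bi that by blast
  have "\<exists>X\<subseteq>\<Union>(\<Union>(?K ` H)). finite X \<and> (\<forall>h\<in>H. X \<inter> \<Union>(?K h) \<noteq> {}) \<and>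
    real (card X) < real p powr (1 / (real p - 1)) * real d powr (real p / (real p - 1)) + real d"
  proof (rule small_hitting_set)
    fix h assume h: "h \<in> H"
    show "?K h \<subseteq> {S. connected_in S}"
    proof safe
      fix c assume c: "c \<in> ?K h"
      then have "c \<noteq> {}" by (simp add: pre_digraph.sccs_verts_def)
      moreover have "c \<subseteq> pverts G" using c UnK[OF h] sub(1)[OF h] by blast
      then have "c \<subseteq> (parcs G)\<^sup>* `` {r}"
        using undirected_tree_reachable[OF assms(1) r] by blast
      moreover have "(x, y) \<in> (parcs G \<inter> c \<times> c)\<^sup>*" if "x \<in> c" "y \<in> c" for x y
        using sccs_verts_connected[OF bi[OF h] c that] sub(2)[OF h]
          rtrancl_mono[of "parcs h \<inter> c \<times> c" "parcs G \<inter> c \<times> c"] by blast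
      ultimately show "connected_in c" by (simp add: connected_in_def)
    qed
    show "finite (?K h)" "card (?K h) \<le> d"
      using assms(5)[OF h] by (auto simp: at_most_components_def)
  next
    fix f assume f: "f \<in> {..<p} \<rightarrow>\<^sub>E H"
    then have "f ` {..<p} \<subseteq> H" by auto
    moreover have "card (f ` {..<p}) \<le> p" using card_image_le[of "{..<p}" f] by simp
    ultimately obtain v where "\<forall>h\<in>f ` {..<p}. v \<in> pverts h"
      using pq_property_common_vertex[OF assms(7,6,3)] by blast
    moreover have "\<Union>(?K (f i)) = pverts (f i)" if "i < p" for i
      using f that by (intro UnK) auto
    ultimately show "\<exists>v. \<forall>i<p. v \<in> \<Union>(?K (f i))" by blast
  qed (use assms \<open>H \<noteq> {}\<close> in auto)
  then obtain X where X: "X \<subseteq> \<Union>(\<Union>(?K ` H))" "finite X" "\<And>h. h \<in> H \<Longrightarrow> X \<inter> \<Union>(?K h) \<noteq> {}"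
    "real (card X) < real p powr (1 / (real p - 1)) * real d powr (real p / (real p - 1)) + real d"
    by blast
  then have "hitting_set G H X"
    using UnK sub(1) unfolding hitting_set_def by blast
  then have "tau G H \<le> card X"
    unfolding tau_def using X(2) by (intro Least_le) blast
  then show ?thesis using X(4) by linarith
qed

end
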